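(* Let $L$ be a finite rectangular modular lattice with top element $1$. Then the following are equivalent. (i) $L$ is $1$-distributive. (ii) $L$ is distributive. (iii) There exists a continuous t-norm on $L$. (iv) There exists a left-continuous t-norm on $L$. (v) There exists a left-continuous pseudo-t-norm on $L$.
   Context: Planar: a finite lattice is planar if it has a Hasse diagram drawn in the plane in which no two of the straight line segments cross. The boundary of $L$ (with respect to such a planar diagram) is the union of its left and right boundary chains, i.e. the leftmost and rightmost maximal chains from $0$ to $1$ in the diagram. Bi-irreducible: $q\in L$ is join-irreducible if $q=x\vee y$ implies $q=x$ or $q=y$, and meet-irreducible if $q=x\wedge y$ implies $q=x$ or $q=y$; it is bi-irreducible if it is both. Rectangular: a rectangular lattice is a planar lattice $L$ with exactly two bi-irreducible elements on the boundary of $L$, these two elements being complementary (their meet is $0$ and their join is $1$) and distinct from $0$ and $1$. $1$-distributive: $L$ is $1$-distributive if for all $a,b,c\in L$, $a\vee b=1$ implies $c\wedge(a\vee b)=(c\wedge a)\vee(c\wedge b)$. Pseudo-t-norm: a binary operation $T:L^2\to L$ on a bounded lattice such that for all $a,b,c$: $T(1,a)=a$ and $T(0,a)=0$; $b\le c$ implies $T(a,b)\le T(a,c)$; and (standing convention) $T(a,b)=T(b,a)$. T-norm: a binary operation $T:L^2\to L$ such that for all $a,b,c$: $T(1,a)=a$; $b\le c$ implies $T(a,b)\le T(a,c)$; $T(a,b)=T(b,a)$; $T(T(a,b),c)=T(a,T(b,c))$. Continuity: a (pseudo-)t-norm $T$ on a complete lattice $L$ is left-continuous if $T(a,\bigvee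 S)=\bigvee_{s\in S}T(a,s)$ for all $a\in L$, $\emptyset\ne S\subseteq L$; right-continuous if $T(a,\bigwedge S)=\bigwedge_{s\in S}T(a,s)$ for all such $a,S$; continuous if both. *)

theory Defs
  imports "HOL-Analysis.Analysis"
begin

unbundle lattice_syntax

section \<open>Planar diagrams\<close>

definition covers :: "'a::order \<Rightarrow> 'a \<Rightarrow> bool" where
  "covers x y \<longleftrightarrow> x < y \<and> \<not> (\<exists>z. x < z \<and> z < y)"

text \<open>
  A drawing places every element at a point of the plane; the edges are the straight line
  segments between the points of covering pairs. Edges go upwards, and the point of an element
  lies on an edge only if it is one of its ends.
\<close>

definition hasse_diagram :: "('a::order \<Rightarrow> real \<times> real) \<Rightarrow> bool" where
  "hasse_diagram pos \<longleftrightarrow> inj pos \<and>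
     (\<forall>x y. covers x y \<longrightarrow> snd (pos x) < snd (pos y)) \<and>
     (\<forall>x y z. covers x y \<longrightarrow> pos z \<in> closed_segment (pos x) (pos y) \<longrightarrow> z = x \<or> z = y)"

text \<open>
  Since edges of a Hasse diagram contain no points of elements other than their ends, two
  distinct edges cross iff their relative interiors meet.
\<close>

definition planar_diagram :: "('a::order \<Rightarrow> real \<times> real) \<Rightarrow> bool" where
  "planar_diagram pos \<longleftrightarrow> hasse_diagram pos \<and>
     (\<forall>a b c d. covers a b \<longrightarrow> covers c d \<longrightarrow> (a, b) \<noteq> (c, d) \<longrightarrow>
        open_segment (pos a) (pos b) \<inter> open_segment (pos c) (pos d) = {})"

abbreviation maximal_chain :: "'a::order set \<Rightarrow> bool" where
  "maximal_chain C \<equiv> pred_on.maxchain UNIV (<) C"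

definition drawn_chain :: "('a::order \<Rightarrow> real \<times> real) \<Rightarrow> 'a set \<Rightarrow> (real \<times> real) set" where
  "drawn_chain pos C = (\<Union>{closed_segment (pos x) (pos y) |x y. x \<in> C \<and> y \<in> C \<and> covers x y})"

text \<open>
  The drawing of a maximal chain is a polygonal path rising from \<open>\<bottom>\<close> to \<open>\<top>\<close>. Two such paths
  are compared horizontally, at each height.
\<close>

definition left_boundary_chain :: "('a::order \<Rightarrow> real \<times> real) \<Rightarrow> 'a set \<Rightarrow> bool" where
  "left_boundary_chain pos C \<longleftrightarrow> maximal_chain C \<and>
     (\<forall>D. maximal_chain D \<longrightarrow>
        (\<forall>p \<in> drawn_chain pos C. \<forall>q \<in> drawn_chain pos D. snd p = snd q \<longrightarrow> fst p \<le> fst q))"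

definition right_boundary_chain :: "('a::order \<Rightarrow> real \<times> real) \<Rightarrow> 'a set \<Rightarrow> bool" where
  "right_boundary_chain pos C \<longleftrightarrow> maximal_chain C \<and>
     (\<forall>D. maximal_chain D \<longrightarrow>
        (\<forall>p \<in> drawn_chain pos C. \<forall>q \<in> drawn_chain pos D. snd p = snd q \<longrightarrow> fst q \<le> fst p))"

definition boundary :: "('a::order \<Rightarrow> real \<times> real) \<Rightarrow> 'a set" where
  "boundary pos = \<Union>{C. left_boundary_chain pos C} \<union> \<Union>{C. right_boundary_chain pos C}"

section \<open>Lattice properties\<close>

definition join_irreducible :: "'a::lattice \<Rightarrow> bool" where
  "join_irreducible q \<longleftrightarrow> (\<forall>x y. q = x \<squnion> y \<longrightarrow> q = x \<or> q = y)"

definition meet_irreducible :: "'a::lattice \<Rightarrow> bool" where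
  "meet_irreducible q \<longleftrightarrow> (\<forall>x y. q = x \<sqinter> y \<longrightarrow> q = x \<or> q = y)"

definition bi_irreducible :: "'a::lattice \<Rightarrow> bool" where
  "bi_irreducible q \<longleftrightarrow> join_irreducible q \<and> meet_irreducible q"

text \<open>
  Properties of a whole lattice take the type carrying it as an argument. Finiteness is not
  part of these predicates; it is a sort constraint wherever they are used.
\<close>

definition rectangular :: "'a::bounded_lattice itself \<Rightarrow> bool" where
  "rectangular L \<longleftrightarrow> (\<exists>pos :: 'a \<Rightarrow> real \<times> real. planar_diagram pos \<and>
     (\<exists>u v. u \<noteq> v \<and> {q \<in> boundary pos. bi_irreducible q} = {u, v} \<and>
        u \<sqinter> v = \<bottom> \<and> u \<squnion> v = \<top> \<and> u \<notin> {\<bottom>, \<top>} \<and> v \<notin> {\<bottom>, \<top>}))"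

definition modular :: "'a::lattice itself \<Rightarrow> bool" where
  "modular L \<longleftrightarrow> (\<forall>x y z :: 'a. x \<le> z \<longrightarrow> x \<squnion> (y \<sqinter> z) = (x \<squnion> y) \<sqinter> z)"

definition distributive :: "'a::lattice itself \<Rightarrow> bool" where
  "distributive L \<longleftrightarrow> class.distrib_lattice (inf :: 'a \<Rightarrow> 'a \<Rightarrow> 'a) (\<le>) (<) sup"

definition one_distributive :: "'a::bounded_lattice itself \<Rightarrow> bool" where
  "one_distributive L \<longleftrightarrow>
     (\<forall>a b c :: 'a. a \<squnion> b = \<top> \<longrightarrow> c \<sqinter> (a \<squnion> b) = (c \<sqinter> a) \<squnion> (c \<sqinter> b))"

section \<open>T-norms\<close>

definition pseudo_t_norm :: "('a::bounded_lattice \<Rightarrow> 'a \<Rightarrow> 'a) \<Rightarrow> bool" where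
  "pseudo_t_norm T \<longleftrightarrow>
     (\<forall>a. T \<top> a = a) \<and> (\<forall>a. T \<bottom> a = \<bottom>) \<and>
     (\<forall>a b c. b \<le> c \<longrightarrow> T a b \<le> T a c) \<and>
     (\<forall>a b. T a b = T b a)"

definition t_norm :: "('a::bounded_lattice \<Rightarrow> 'a \<Rightarrow> 'a) \<Rightarrow> bool" where
  "t_norm T \<longleftrightarrow>
     (\<forall>a. T \<top> a = a) \<and>
     (\<forall>a b c. b \<le> c \<longrightarrow> T a b \<le> T a c) \<and>
     (\<forall>a b. T a b = T b a) \<and>
     (\<forall>a b c. T (T a b) c = T a (T b c))"

definition left_continuous :: "('a::complete_lattice \<Rightarrow> 'a \<Rightarrow> 'a) \<Rightarrow> bool" where
  "left_continuous T \<longleftrightarrow> (\<forall>a S. S \<noteq> {} \<longrightarrow> T a (\<Squnion>S) = (\<Squnion>s\<in>S. T a s))"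

definition right_continuous :: "('a::complete_lattice \<Rightarrow> 'a \<Rightarrow> 'a) \<Rightarrow> bool" where
  "right_continuous T \<longleftrightarrow> (\<forall>a S. S \<noteq> {} \<longrightarrow> T a (\<Sqinter>S) = (\<Sqinter>s\<in>S. T a s))"

end

theory Submission
  imports Defs
begin

text \<open>
  A left-continuous pseudo-t-norm \<open>T\<close> satisfies \<open>T c a \<le> c \<sqinter> a\<close>, so \<open>a \<squnion> b = \<top>\<close> gives
  \<open>c = T c a \<squnion> T c b \<le> (c \<sqinter> a) \<squnion> (c \<sqinter> b)\<close>, which is 1-distributivity; conversely \<open>\<sqinter>\<close> is a
  continuous t-norm on a finite distributive lattice. The substance is that 1-distributivity
  implies distributivity. Applied to the complementary corners \<open>u\<close>, \<open>v\<close>, it gives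
  \<open>c = (c \<sqinter> u) \<squnion> (c \<sqinter> v)\<close> for all \<open>c\<close>, so by modularity the lattice is the direct product of the
  intervals \<open>[\<bottom>, u]\<close> and \<open>[\<bottom>, v]\<close>. Both are chains: two incomparable elements below \<open>u\<close> and an
  atom below \<open>v\<close> would span a cover-preserving Boolean cube, and a planar diagram contains none.
  Indeed, of the three edges leaving the bottom \<open>o\<close> of the cube upwards, the middle one, to \<open>b\<close>,
  starts out inside the region enclosed by the paths \<open>o, a, a \<squnion> c\<close> and \<open>o, c, a \<squnion> c\<close>; a path from
  \<open>b\<close> to the top of the cube avoiding \<open>a\<close>, \<open>c\<close> and \<open>a \<squnion> c\<close> cannot leave this region.
\<close>

section \<open>Paths in planar diagrams\<close>

text \<open>Linear interpolation along an edge, parametrised by height. On a covering pair of a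
  Hasse diagram the denominator is positive, because edges rise.\<close>

definition edge_abscissa :: "('a::order \<Rightarrow> real \<times> real) \<Rightarrow> 'a \<Rightarrow> 'a \<Rightarrow> real \<Rightarrow> real" where
  "edge_abscissa pos x y t = fst (pos x) +
     (t - snd (pos x)) / (snd (pos y) - snd (pos x)) * (fst (pos y) - fst (pos x))"

text \<open>A rising path is recorded by its abscissa \<open>f\<close> as a function of the height.\<close>

definition path_abscissa ::
    "('a::order \<Rightarrow> real \<times> real) \<Rightarrow> 'a set \<Rightarrow> 'a \<Rightarrow> 'a \<Rightarrow> (real \<Rightarrow> real) \<Rightarrow> bool" where
  "path_abscissa pos V x y f \<longleftrightarrow>
     continuous_on {snd (pos x)..snd (pos y)} f \<and>
     f (snd (pos x)) = fst (pos x) \<and> f (snd (pos y)) = fst (pos y) \<and>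
     (\<forall>t\<in>{snd (pos x)..snd (pos y)}. \<exists>p\<in>V. \<exists>q\<in>V.
        covers p q \<and> (f t, t) \<in> closed_segment (pos p) (pos q))"

lemma hasse_diagram_height:
  "hasse_diagram pos \<Longrightarrow> covers x y \<Longrightarrow> snd (pos x) < snd (pos y)"
  by (simp add: hasse_diagram_def)

lemma path_abscissa_edge:
  assumes "hasse_diagram pos" "covers x y"
  shows "path_abscissa pos {x, y} x y (edge_abscissa pos x y)"
proof -
  have h: "snd (pos x) < snd (pos y)"
    using assms by (rule hasse_diagram_height)
  have "(edge_abscissa pos x y t, t) \<in> closed_segment (pos x) (pos y)"
    if t: "snd (pos x) \<le> t" "t \<le> snd (pos y)" for t
  proof -
    define s where "s = (t - snd (pos x)) / (snd (pos y) - snd (pos x))"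
    have s: "0 \<le> s" "s \<le> 1" "t = snd (pos x) + s * (snd (pos y) - snd (pos x))"
      using t h by (auto simp: s_def field_simps)
    have "(edge_abscissa pos x y t, t) = (1 - s) *\<^sub>R pos x + s *\<^sub>R pos y"
      using s(3) by (auto simp: edge_abscissa_def s_def[symmetric] prod_eq_iff algebra_simps)
    then show ?thesis
      using s by (auto simp: closed_segment_def)
  qed
  moreover have "continuous_on {snd (pos x)..snd (pos y)} (edge_abscissa pos x y)"
    unfolding edge_abscissa_def using h by (intro continuous_intros) auto
  ultimately show ?thesis
    using assms h by (auto simp: path_abscissa_def edge_abscissa_def)
qed

text \<open>At the height of \<open>y\<close> both pieces have the abscissa of \<open>y\<close>, so
  they glue to a continuous function.\<close>

lemma path_abscissa_join:
  assumes f: "path_abscissa pos V x y f" and g: "path_abscissa pos W y z g"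
    and h: "snd (pos x) \<le> snd (pos y)" "snd (pos y) \<le> snd (pos z)"
  shows "path_abscissa pos (V \<union> W) x z (\<lambda>t. if t \<le> snd (pos y) then f t else g t)"
    (is "path_abscissa _ _ _ _ ?k")
proof -
  have "continuous_on ({snd (pos x)..snd (pos y)} \<union> {snd (pos y)..snd (pos z)}) ?k"
    using f g by (intro continuous_on_If) (auto simp: path_abscissa_def)
  moreover have "{snd (pos x)..snd (pos y)} \<union> {snd (pos y)..snd (pos z)}
      = {snd (pos x)..snd (pos z)}"
    using h by auto
  ultimately have "continuous_on {snd (pos x)..snd (pos z)} ?k"
    by simp
  moreover have "\<exists>p\<in>V \<union> W. \<exists>q\<in>V \<union> W. covers p q \<and> (?k t, t) \<in> closed_segment (pos p) (pos q)"
    if "t \<in> {snd (pos x)..snd (pos z)}" for t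
  proof (cases "t \<le> snd (pos y)")
    case True
    then have "t \<in> {snd (pos x)..snd (pos y)}" using that by auto
    then show ?thesis using f True unfolding path_abscissa_def by (metis UnI1)
  next
    case False
    then have "t \<in> {snd (pos y)..snd (pos z)}" using that by auto
    then show ?thesis using g False unfolding path_abscissa_def by (metis UnI2)
  qed
  ultimately show ?thesis
    using f g h by (auto simp: path_abscissa_def)
qed

text \<open>Relative interiors of distinct edges are disjoint, so a common point is an end of one of
  them; being the point of an element, it can lie on the other edge only as an end.\<close>

lemma planar_diagram_segments_meet:
  assumes P: "planar_diagram pos" and c: "covers a b" "covers c d"
    and p: "p \<in> closed_segment (pos a) (pos b)" "p \<in> closed_segment (pos c) (pos d)"
  obtains "a = c" "b = d" | x where "x \<in> {a, b}" "x \<in> {c, d}" "p = pos x"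
proof (cases "(a, b) = (c, d)")
  case True
  then show ?thesis using that(1) by simp
next
  case False
  then have "open_segment (pos a) (pos b) \<inter> open_segment (pos c) (pos d) = {}"
    using P c unfolding planar_diagram_def by blast
  then have "p \<in> {pos a, pos b} \<or> p \<in> {pos c, pos d}"
    using p unfolding open_segment_def by blast
  moreover have H: "z = x \<or> z = y"
    if "covers x y" "pos z \<in> closed_segment (pos x) (pos y)" for x y z
    using P that unfolding planar_diagram_def hasse_diagram_def by blast
  ultimately show ?thesis
    using H[OF c(1)] H[OF c(2)] p that(2) by blast
qed

text \<open>A common point lies on an edge of each path. Either the edges coincide and both ends lie
  in \<open>V \<inter> W\<close>, or they share a vertex at that point; the first is impossible
  since \<open>V \<inter> W\<close> has at most one element, the second since \<open>t\<close> is
  above \<open>x\<close>.\<close>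

lemma path_abscissa_disjoint:
  assumes P: "planar_diagram pos"
    and f: "path_abscissa pos V x y f" and g: "path_abscissa pos W x' y' g"
    and VW: "V \<inter> W \<subseteq> {x}" "x' = x"
    and t: "snd (pos x) < t" "t \<le> snd (pos y)" "t \<le> snd (pos y')"
  shows "f t \<noteq> g t"
proof
  assume eq: "f t = g t"
  obtain p q where pq: "p \<in> V" "q \<in> V" "covers p q" "(f t, t) \<in> closed_segment (pos p) (pos q)"
    using f t unfolding path_abscissa_def by (metis atLeastAtMost_iff less_imp_le)
  obtain p' q' where pq': "p' \<in> W" "q' \<in> W" "covers p' q'"
      "(f t, t) \<in> closed_segment (pos p') (pos q')"
    using g t VW(2) unfolding path_abscissa_def eq by (metis atLeastAtMost_iff less_imp_le)
  show False
  proof (rule planar_diagram_segments_meet[OF P pq(3) pq'(3) pq(4) pq'(4)])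
    assume "p = p'" "q = q'"
    then have "p = x" "q = x" using VW pq pq' by auto
    then show False using pq(3) by (simp add: covers_def)
  next
    fix z assume "z \<in> {p, q}" "z \<in> {p', q'}" and z: "(f t, t) = pos z"
    then have "z = x" using VW pq pq' by auto
    then show False using z t(1) by (metis less_irrefl snd_conv)
  qed
qed

section \<open>Non-crossing paths and Boolean cubes\<close>

lemma continuous_on_no_crossing:
  fixes f g :: "real \<Rightarrow> real"
  assumes "continuous_on {s..t} f" "continuous_on {s..t} g" "s \<le> t"
    and "\<And>r. s \<le> r \<Longrightarrow> r \<le> t \<Longrightarrow> f r \<noteq> g r" and "f s < g s"
  shows "f t < g t"
proof (rule ccontr)
  assume "\<not> f t < g t"
  moreover have "continuous_on {s..t} (\<lambda>r. f r - g r)"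
    using assms by (intro continuous_intros)
  ultimately obtain r where "s \<le> r" "r \<le> t" "f r - g r = 0"
    using IVT'[of "\<lambda>r. f r - g r" s 0 t] assms by auto
  then show False using assms(4) by auto
qed

text \<open>The paths \<open>o', a, d\<close> and \<open>o', c, d\<close> close up at
  \<open>d\<close>. The path \<open>o', b, e, i\<close> shares only \<open>o'\<close> with them and
  lies strictly between them at height \<open>t\<close>, hence also at the height of
  \<open>d\<close>, where no room is left.\<close>

lemma planar_diagram_middle_trapped:
  fixes o' a b c d e i :: "'a::order" and pos :: "'a \<Rightarrow> real \<times> real"
  assumes P: "planar_diagram pos"
    and c: "covers o' a" "covers o' b" "covers o' c" "covers a d" "covers c d" "covers d i"
      "covers b e" "covers e i"
    and disj: "{b, e, i} \<inter> {a, c, d} = {}"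
    and t: "snd (pos o') < t" "t \<le> snd (pos a)" "t \<le> snd (pos b)" "t \<le> snd (pos c)"
    and ord: "edge_abscissa pos o' a t < edge_abscissa pos o' b t"
      "edge_abscissa pos o' b t < edge_abscissa pos o' c t"
  shows False
proof -
  have H: "hasse_diagram pos"
    using P by (simp add: planar_diagram_def)
  note h = c[THEN hasse_diagram_height[OF H]]
  note E = c[THEN path_abscissa_edge[OF H]]
  define l where "l = (\<lambda>r. if r \<le> snd (pos a) then edge_abscissa pos o' a r
    else edge_abscissa pos a d r)"
  define k where "k = (\<lambda>r. if r \<le> snd (pos c) then edge_abscissa pos o' c r
    else edge_abscissa pos c d r)"
  define m' where "m' = (\<lambda>r. if r \<le> snd (pos e) then edge_abscissa pos b e r
    else edge_abscissa pos e i r)"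
  define m where "m = (\<lambda>r. if r \<le> snd (pos b) then edge_abscissa pos o' b r else m' r)"
  have l: "path_abscissa pos ({o', a} \<union> {a, d}) o' d l"
    unfolding l_def using h by (intro path_abscissa_join E) auto
  have k: "path_abscissa pos ({o', c} \<union> {c, d}) o' d k"
    unfolding k_def using h by (intro path_abscissa_join E) auto
  have "path_abscissa pos ({b, e} \<union> {e, i}) b i m'"
    unfolding m'_def using h by (intro path_abscissa_join E) auto
  then have m: "path_abscissa pos ({o', b} \<union> ({b, e} \<union> {e, i})) o' i m"
    unfolding m_def using h by (intro path_abscissa_join E) auto
  have ne: "o' \<noteq> a" "o' \<noteq> c" "o' \<noteq> d" "o' \<noteq> b" "o' \<noteq> e" "o' \<noteq> i"
    using h by auto
  have lm: "l r \<noteq> m r" and mk: "m r \<noteq> k r" if "t \<le> r" "r \<le> snd (pos d)" for r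
    using disj ne that h t
    by (intro path_abscissa_disjoint[OF P l m] path_abscissa_disjoint[OF P m k]; auto)+
  have cont: "continuous_on {snd (pos o')..snd (pos d)} l"
      "continuous_on {snd (pos o')..snd (pos i)} m" "continuous_on {snd (pos o')..snd (pos d)} k"
    using l m k by (auto simp: path_abscissa_def)
  \<comment> \<open>Since \<open>d\<close> lies below \<open>i\<close>, the middle path is defined
    up to the height of \<open>d\<close>.\<close>
  have range: "{t..snd (pos d)} \<subseteq> {snd (pos o')..snd (pos d)}"
      "{t..snd (pos d)} \<subseteq> {snd (pos o')..snd (pos i)}"
    using h t by auto
  note sub = continuous_on_subset[OF cont(1) range(1)] continuous_on_subset[OF cont(2) range(2)]
    continuous_on_subset[OF cont(3) range(1)]
  have td: "t \<le> snd (pos d)"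
    using h t by auto
  have "l t < m t" "m t < k t"
    using ord t by (simp_all add: l_def m_def k_def)
  then have "l (snd (pos d)) < m (snd (pos d))" "m (snd (pos d)) < k (snd (pos d))"
    using continuous_on_no_crossing[OF sub(1,2) td lm] continuous_on_no_crossing[OF sub(2,3) td mk]
    by blast+
  then show False
    using l k by (simp add: path_abscissa_def)
qed

lemma planar_diagram_no_cube:
  fixes o' a b c ab ac bc i :: "'a::order" and pos :: "'a \<Rightarrow> real \<times> real"
  assumes P: "planar_diagram pos"
    and atoms: "covers o' a" "covers o' b" "covers o' c"
    and coatoms: "covers ab i" "covers ac i" "covers bc i"
    and ab: "covers a ab" "covers b ab" and ac: "covers a ac" "covers c ac"
    and bc: "covers b bc" "covers c bc"
    and dist: "a \<noteq> b" "a \<noteq> c" "b \<noteq> c" "ab \<noteq> ac" "ab \<noteq> bc" "ac \<noteq> bc"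
  shows False
proof -
  have H: "hasse_diagram pos"
    using P by (simp add: planar_diagram_def)
  note E = atoms[THEN path_abscissa_edge[OF H]]
  note h = atoms[THEN hasse_diagram_height[OF H]]
  have nc: "\<not> covers x y" if "covers o' x" "covers o' y" for x y
    using that unfolding covers_def by blast
  have nc': "x \<noteq> i" if "covers o' y" "covers y z" "covers z i" "covers o' x" for x y z
    using that unfolding covers_def by (metis less_trans)
  \<comment> \<open>All three bottom edges reach the height of the lowest atom, so their order from
    left to right can be read off there.\<close>
  define t where "t = min (snd (pos a)) (min (snd (pos b)) (snd (pos c)))"
  have t: "snd (pos o') < t" "t \<le> snd (pos a)" "t \<le> snd (pos b)" "t \<le> snd (pos c)"
    using h by (auto simp: t_def)
  have ne: "o' \<noteq> a" "o' \<noteq> b" "o' \<noteq> c"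
    using h by auto
  have atom_ne: "x \<noteq> y" if "x \<in> {a, b, c}" "y \<in> {ab, ac, bc, i}" for x y
    using that nc nc' atoms coatoms ab ac bc by blast
  have top_ne: "i \<noteq> ab" "i \<noteq> ac" "i \<noteq> bc"
    using coatoms by (auto simp: covers_def)
  have disj: "{b, ab, i} \<inter> {a, c, ac} = {}" "{c, ac, i} \<inter> {a, b, ab} = {}"
      "{a, ab, i} \<inter> {b, c, bc} = {}" "{c, ac, i} \<inter> {b, a, ab} = {}"
      "{a, ab, i} \<inter> {c, b, bc} = {}" "{b, ab, i} \<inter> {c, a, ac} = {}"
    using dist top_ne atom_ne by blast+
  note M = planar_diagram_middle_trapped[OF P]
  let ?f = "\<lambda>x. edge_abscissa pos o' x t"
  have "?f a \<noteq> ?f b" "?f a \<noteq> ?f c" "?f b \<noteq> ?f c"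
    using ne dist t
    by (intro path_abscissa_disjoint[OF P E(1) E(2)] path_abscissa_disjoint[OF P E(1) E(3)]
      path_abscissa_disjoint[OF P E(2) E(3)]; auto)+
  then consider "?f a < ?f b" "?f b < ?f c" | "?f a < ?f c" "?f c < ?f b"
    | "?f b < ?f a" "?f a < ?f c" | "?f b < ?f c" "?f c < ?f a"
    | "?f c < ?f a" "?f a < ?f b" | "?f c < ?f b" "?f b < ?f a"
    by linarith
  then show False
  \<comment> \<open>In each case the outer paths close at the common upper cover of the two outer
    atoms, and the middle atom escapes to \<open>i\<close> through an upper cover shared with one of
    them.\<close>
  proof cases
    case 1
    then show False
      by (rule M[OF atoms ac coatoms(2) ab(2) coatoms(1) disj(1) t])
  next
    case 2
    then show False
      by (rule M[OF atoms(1,3,2) ab coatoms(1) ac(2) coatoms(2) disj(2) t(1,2,4,3)])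
  next
    case 3
    then show False
      by (rule M[OF atoms(2,1,3) bc coatoms(3) ab(1) coatoms(1) disj(3) t(1,3,2,4)])
  next
    case 4
    then show False
      by (rule M[OF atoms(2,3,1) ab(2,1) coatoms(1) ac(2) coatoms(2) disj(4) t(1,3,4,2)])
  next
    case 5
    then show False
      by (rule M[OF atoms(3,1,2) bc(2,1) coatoms(3) ab(1) coatoms(1) disj(5) t(1,4,2,3)])
  next
    case 6
    then show False
      by (rule M[OF atoms(3,2,1) ac(2,1) coatoms(2) ab(2) coatoms(1) disj(6) t(1,4,3,2)])
  qed
qed

section \<open>Modular lattices\<close>

lemma modular_law:
  fixes x y z :: "'a::lattice"
  assumes "modular TYPE('a)" "x \<le> z"
  shows "x \<squnion> (y \<sqinter> z) = (x \<squnion> y) \<sqinter> z"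
  using assms by (simp add: modular_def)

text \<open>The transposed intervals \<open>[x \<sqinter> y, x]\<close> and
  \<open>[y, x \<squnion> y]\<close> correspond: \<open>z\<close> is recovered from
  \<open>x \<sqinter> z\<close> as \<open>y \<squnion> (x \<sqinter> z)\<close>.\<close>

lemma modular_covers_sup:
  fixes x y :: "'a::lattice"
  assumes M: "modular TYPE('a)" and c: "covers (x \<sqinter> y) x"
  shows "covers y (x \<squnion> y)"
proof -
  have "\<not> x \<le> y"
    using c by (auto simp: covers_def inf_absorb1)
  then have "y < x \<squnion> y"
    by (metis sup.cobounded1 sup.cobounded2 order_le_neq_trans)
  moreover have False if z: "y < z" "z < x \<squnion> y" for z
  proof -
    have "z = y \<squnion> (x \<sqinter> z)"
      using modular_law[OF M, of y z x] z by (simp add: sup.commute inf.absorb2 less_imp_le)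
    moreover have "x \<sqinter> y \<le> x \<sqinter> z"
      using z by (simp add: inf.coboundedI2 less_imp_le)
    then have "x \<sqinter> z = x \<sqinter> y \<or> x \<sqinter> z = x"
      using c unfolding covers_def by (metis inf.cobounded1 order_le_less)
    ultimately show False
      using z by (metis inf.cobounded2 sup.absorb1 sup.commute less_irrefl)
  qed
  ultimately show ?thesis
    by (auto simp: covers_def)
qed

text \<open>Three independent covers of \<open>o'\<close> generate a Boolean cube, and transposition
  makes each of its edges a covering pair.\<close>

lemma planar_modular_no_independent_covers:
  fixes o' p q r :: "'a::lattice"
  assumes P: "planar_diagram (pos :: 'a \<Rightarrow> real \<times> real)" and M: "modular TYPE('a)"
    and c: "covers o' p" "covers o' q" "covers o' r" "p \<noteq> q" and r: "r \<sqinter> (p \<squnion> q) = o'"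
  shows False
proof -
  have le: "o' \<le> p" "o' \<le> q" "o' \<le> r"
    using c by (auto simp: covers_def)
  have pq: "p \<sqinter> q = o'"
    using c le unfolding covers_def
    by (metis inf.cobounded1 inf.cobounded2 inf_greatest order_le_less)
  have pr: "p \<sqinter> r = o'" and qr: "q \<sqinter> r = o'"
    using r le by (metis antisym inf_greatest inf.cobounded1 inf.cobounded2 le_supI1 le_supI2)+
  \<comment> \<open>The hypothesis singles out \<open>r\<close>. Two uses of the modular law make
    independence symmetric, yielding \<open>qpr\<close> and \<open>pqr\<close> below.\<close>
  have "p \<squnion> (r \<sqinter> (p \<squnion> q)) = (p \<squnion> r) \<sqinter> (p \<squnion> q)"
    by (rule modular_law[OF M]) simp
  then have p: "(p \<squnion> r) \<sqinter> (p \<squnion> q) = p"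
    using r le by (simp add: sup_absorb1)
  have "q \<squnion> (r \<sqinter> (p \<squnion> q)) = (q \<squnion> r) \<sqinter> (p \<squnion> q)"
    by (rule modular_law[OF M]) simp
  then have q: "(q \<squnion> r) \<sqinter> (p \<squnion> q) = q"
    using r le by (simp add: sup_absorb1)
  have qpr: "q \<sqinter> (p \<squnion> r) = o'"
    using p pq by (metis inf.absorb1 inf.assoc inf.commute sup.cobounded2)
  have pqr: "p \<sqinter> (q \<squnion> r) = o'"
    using q pq by (metis inf.absorb1 inf.assoc inf.commute sup.cobounded1)
  note S = modular_covers_sup[OF M]
  have ne: "p \<squnion> q \<noteq> p \<squnion> r" "p \<squnion> q \<noteq> q \<squnion> r" "p \<squnion> r \<noteq> q \<squnion> r"
    using c p q r pq pr qr qpr pqr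
    by (auto simp: covers_def) (metis inf.absorb1 less_irrefl sup.cobounded1 sup.cobounded2)+
  show False
  proof (rule planar_diagram_no_cube[OF P c(1-3)])
    show "covers (p \<squnion> q) (p \<squnion> q \<squnion> r)"
      using S[of r "p \<squnion> q"] r c by (simp add: ac_simps)
    show "covers (p \<squnion> r) (p \<squnion> q \<squnion> r)"
      using S[of q "p \<squnion> r"] qpr c by (simp add: ac_simps)
    show "covers (q \<squnion> r) (p \<squnion> q \<squnion> r)"
      using S[of p "q \<squnion> r"] pqr c by (simp add: ac_simps)
    show "covers p (p \<squnion> q)" "covers p (p \<squnion> r)"
      using S[of q p] S[of r p] pq pr c by (simp_all add: ac_simps)
    show "covers q (p \<squnion> q)" "covers q (q \<squnion> r)"
      using S[of p q] S[of r q] pq qr c by (simp_all add: ac_simps)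
    show "covers r (p \<squnion> r)" "covers r (q \<squnion> r)"
      using S[of p r] S[of q r] pr qr c by (simp_all add: ac_simps)
    show "p \<noteq> r" "q \<noteq> r"
      using c pr qr by (auto simp: covers_def)
  qed (use c ne in auto)
qed

section \<open>Decomposition along complementary elements\<close>

lemma covers_below:
  fixes x y :: "'a::{finite, order}"
  assumes "x < y"
  obtains z where "covers x z" "z \<le> y"
proof -
  obtain z where z: "z \<in> {z. x < z \<and> z \<le> y}" "\<And>w. w \<in> {z. x < z \<and> z \<le> y} \<Longrightarrow> w \<le> z \<Longrightarrow> z = w"
    using finite_has_minimal[of "{z. x < z \<and> z \<le> y}"] assms
    by (metis (lifting) empty_iff finite mem_Collect_eq order_refl)
  then have "covers x z"
    unfolding covers_def
    by (metis (lifting) dual_order.strict_implies_order mem_Collect_eq order.trans order_less_irrefl)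
  with z show ?thesis using that by blast
qed

text \<open>Incomparable \<open>x\<close> and \<open>y\<close> give two covers of
  \<open>x \<sqinter> y\<close> below \<open>u\<close>; an atom below \<open>v\<close>, joined with
  \<open>x \<sqinter> y\<close>, provides a third one independent of them.\<close>

lemma planar_modular_chain_below_complement:
  fixes u v x y :: "'a::{finite, bounded_lattice}"
  assumes P: "planar_diagram (pos :: 'a \<Rightarrow> real \<times> real)" and M: "modular TYPE('a)"
    and uv: "u \<sqinter> v = \<bottom>" "v \<noteq> \<bottom>" and xy: "x \<le> u" "y \<le> u"
  shows "x \<le> y \<or> y \<le> x"
proof (rule ccontr)
  assume n: "\<not> (x \<le> y \<or> y \<le> x)"
  define o' where "o' = x \<sqinter> y"
  have "o' < x" "o' < y"
    using n unfolding o'_def by (metis inf.cobounded1 inf.cobounded2 order_le_less)+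
  then obtain p q where p: "covers o' p" "p \<le> x" and q: "covers o' q" "q \<le> y"
    by (metis covers_below)
  have "p \<noteq> q"
    using p q unfolding o'_def covers_def by (metis inf_greatest leD)
  obtain b where b: "covers \<bottom> b" "b \<le> v"
    using covers_below[of \<bottom> v] uv(2) bot.not_eq_extremum by metis
  have pu: "p \<squnion> q \<le> u" "o' \<le> p \<squnion> q"
    using p q xy by (auto simp: covers_def intro: le_supI1 order_trans less_imp_le)
  have b_disj: "b \<sqinter> z = \<bottom>" if "z \<le> u" for z
    using that b(2) uv(1) by (metis bot_unique inf.commute inf_mono)
  \<comment> \<open>The covering of \<open>\<bottom>\<close> by \<open>b\<close> is transposed up to
    \<open>o'\<close>, since \<open>b\<close> meets everything below \<open>u\<close> in
    \<open>\<bottom>\<close>.\<close>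
  have "covers o' (b \<squnion> o')"
    using modular_covers_sup[OF M, of b o'] b(1) b_disj[of o'] pu by auto
  moreover have "(b \<squnion> o') \<sqinter> (p \<squnion> q) = o'"
    using modular_law[OF M pu(2), of b] b_disj[OF pu(1)] by (simp add: sup.commute)
  ultimately show False
    using planar_modular_no_independent_covers[OF P M p(1) q(1)] \<open>p \<noteq> q\<close> by blast
qed

text \<open>A join of a part below \<open>u\<close> and a part below \<open>v\<close> determines its
  first part, so such decompositions are unique.\<close>

lemma modular_inf_sup_complement:
  fixes u v x y :: "'a::bounded_lattice"
  assumes "modular TYPE('a)" "u \<sqinter> v = \<bottom>" "x \<le> u" "y \<le> v"
  shows "(x \<squnion> y) \<sqinter> u = x"
proof -
  have "y \<sqinter> u = \<bottom>"
    using assms by (metis bot_unique inf.commute inf_mono order_refl)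
  then show ?thesis
    using modular_law[OF assms(1,3), of y] by simp
qed

text \<open>Distributivity of a chain, stated for three pairwise comparable elements so that it
  applies inside an interval.\<close>

lemma inf_sup_distrib_comparable:
  fixes x y z :: "'a::lattice"
  assumes "x \<le> y \<or> y \<le> x" "x \<le> z \<or> z \<le> x" "y \<le> z \<or> z \<le> y"
  shows "x \<sqinter> (y \<squnion> z) = (x \<sqinter> y) \<squnion> (x \<sqinter> z)"
  using assms by (auto simp: inf_absorb1 inf_absorb2 sup_absorb1 sup_absorb2 le_supI1 le_supI2)

lemma distributiveI:
  assumes "\<And>x y z :: 'a::lattice. x \<sqinter> (y \<squnion> z) = (x \<sqinter> y) \<squnion> (x \<sqinter> z)"
  shows "distributive TYPE('a)"
  unfolding distributive_def
  by unfold_locales (rule distrib_imp1, rule assms)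

lemma distributive_inf_sup:
  fixes x y z :: "'a::lattice"
  assumes "distributive TYPE('a)"
  shows "x \<sqinter> (y \<squnion> z) = (x \<sqinter> y) \<squnion> (x \<sqinter> z)"
  using distrib_lattice.inf_sup_distrib1[OF assms[unfolded distributive_def]] .

text \<open>Joins and meets are computed coordinatewise under
  \<open>c \<mapsto> (c \<sqinter> u, c \<sqinter> v)\<close>, and each coordinate ranges over a
  chain.\<close>

lemma distributive_if_one_distributive:
  assumes R: "rectangular TYPE('a::{finite, bounded_lattice})" and M: "modular TYPE('a)"
    and D: "one_distributive TYPE('a)"
  shows "distributive TYPE('a)"
proof (rule distributiveI)
  fix x y z :: 'a
  obtain pos :: "'a \<Rightarrow> real \<times> real" and u v :: 'a where P: "planar_diagram pos"
    and uv: "u \<sqinter> v = \<bottom>" "u \<squnion> v = \<top>" "u \<noteq> \<bottom>" "v \<noteq> \<bottom>"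
    using R unfolding rectangular_def by blast
  have vu: "v \<sqinter> u = \<bottom>"
    using uv(1) by (simp add: inf.commute)
  have split: "c = (c \<sqinter> u) \<squnion> (c \<sqinter> v)" for c
    using D uv(2) unfolding one_distributive_def by (metis inf_top_right)
  \<comment> \<open>Regrouping into a part below \<open>u\<close> and a part below \<open>v\<close>
    gives the form in which \<open>modular_inf_sup_complement\<close> reads off a
    coordinate.\<close>
  have sup_split: "c \<squnion> d = ((c \<sqinter> u) \<squnion> (d \<sqinter> u)) \<squnion> ((c \<sqinter> v) \<squnion> (d \<sqinter> v))" for c d
    using split[of c] split[of d] by (metis sup.assoc sup.commute)
  have sup_u: "(c \<squnion> d) \<sqinter> u = (c \<sqinter> u) \<squnion> (d \<sqinter> u)" for c d
    unfolding sup_split[of c d] by (rule modular_inf_sup_complement[OF M uv(1)]) auto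
  have sup_v: "(c \<squnion> d) \<sqinter> v = (c \<sqinter> v) \<squnion> (d \<sqinter> v)" for c d
    unfolding sup_split[of c d] sup.commute[of "(c \<sqinter> u) \<squnion> (d \<sqinter> u)"]
    by (rule modular_inf_sup_complement[OF M vu]) auto
  have dist: "(x \<sqinter> w) \<sqinter> ((y \<sqinter> w) \<squnion> (z \<sqinter> w)) = (x \<sqinter> w) \<sqinter> (y \<sqinter> w) \<squnion> (x \<sqinter> w) \<sqinter> (z \<sqinter> w)"
    if "w = u \<or> w = v" for w
  proof -
    have "p \<le> q \<or> q \<le> p" if "p \<le> w" "q \<le> w" for p q
      using \<open>w = u \<or> w = v\<close> that planar_modular_chain_below_complement[OF P M uv(1,4)]
        planar_modular_chain_below_complement[OF P M vu uv(3)] by blast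
    then show ?thesis
      by (intro inf_sup_distrib_comparable) (meson inf.cobounded2)+
  qed
  have inf_w: "(c \<sqinter> d) \<sqinter> w = (c \<sqinter> w) \<sqinter> (d \<sqinter> w)" for c d w :: 'a
    by (metis inf.assoc inf.commute inf.idem)
  have "(x \<sqinter> (y \<squnion> z)) \<sqinter> u = ((x \<sqinter> y) \<squnion> (x \<sqinter> z)) \<sqinter> u"
    using dist[OF disjI1, OF refl] by (simp only: inf_w[of _ _ u] sup_u)
  moreover have "(x \<sqinter> (y \<squnion> z)) \<sqinter> v = ((x \<sqinter> y) \<squnion> (x \<sqinter> z)) \<sqinter> v"
    using dist[OF disjI2, OF refl] by (simp only: inf_w[of _ _ v] sup_v)
  \<comment> \<open>By \<open>split\<close>, elements with equal coordinates are equal.\<close>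
  ultimately show "x \<sqinter> (y \<squnion> z) = (x \<sqinter> y) \<squnion> (x \<sqinter> z)"
    using split by metis
qed

section \<open>T-norms\<close>

lemma one_distributive_if_left_continuous:
  fixes T :: "'a::complete_lattice \<Rightarrow> 'a \<Rightarrow> 'a"
  assumes T: "pseudo_t_norm T" and C: "left_continuous T"
  shows "one_distributive TYPE('a)"
  unfolding one_distributive_def
proof (intro allI impI)
  fix a b c :: 'a
  assume ab: "a \<squnion> b = \<top>"
  \<comment> \<open>Monotonicity bounds \<open>T x y\<close> by \<open>T x \<top> = x\<close>;
    commutativity gives the bound \<open>y\<close>.\<close>
  have T_le: "T x y \<le> x \<sqinter> y" for x y
    using T unfolding pseudo_t_norm_def by (metis le_inf_iff top_greatest)
  have "c = T c (\<Squnion>{a, b})"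
    using T ab unfolding pseudo_t_norm_def by simp
  also have "\<dots> = T c a \<squnion> T c b"
    using C unfolding left_continuous_def by (simp only: insert_not_empty not_False_eq_True) simp
  also have "\<dots> \<le> (c \<sqinter> a) \<squnion> (c \<sqinter> b)"
    by (intro sup_mono T_le)
  finally have "c \<sqinter> (a \<squnion> b) \<le> (c \<sqinter> a) \<squnion> (c \<sqinter> b)"
    using ab by simp
  then show "c \<sqinter> (a \<squnion> b) = (c \<sqinter> a) \<squnion> (c \<sqinter> b)"
    by (simp add: antisym le_infI2)
qed

text \<open>The zero law is the one axiom to derive: \<open>T \<bottom> a \<le> T \<bottom> \<top> =
  T \<top> \<bottom> = \<bottom>\<close>.\<close>

lemma pseudo_t_norm_if_t_norm:
  assumes "t_norm T"
  shows "pseudo_t_norm T"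
proof -
  have "T \<bottom> a \<le> T \<bottom> \<top>" for a
    using assms by (simp add: t_norm_def)
  moreover have "T \<bottom> \<top> = T \<top> \<bottom>" "T \<top> \<bottom> = \<bottom>"
    using assms unfolding t_norm_def by blast+
  ultimately have "\<forall>a. T \<bottom> a = \<bottom>"
    by (simp add: bot_unique)
  then show ?thesis
    using assms unfolding t_norm_def pseudo_t_norm_def by - (elim conjE, intro conjI)
qed

lemma t_norm_inf: "t_norm inf"
  by (auto simp: t_norm_def ac_simps intro: le_infI2)

text \<open>In a finite lattice a nonempty supremum is an iterated binary join, so the binary law
  extends by induction.\<close>

lemma left_continuous_inf:
  assumes "distributive TYPE('a::{finite, complete_lattice})"
  shows "left_continuous (inf :: 'a \<Rightarrow> 'a \<Rightarrow> 'a)"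
proof -
  have "a \<sqinter> \<Squnion>S = (\<Squnion>s\<in>S. a \<sqinter> s)" if "finite S" "S \<noteq> {}" for a :: 'a and S
    using that by (induction rule: finite_ne_induct) (simp_all add: distributive_inf_sup[OF assms])
  then show ?thesis by (simp add: left_continuous_def)
qed

lemma right_continuous_inf: "right_continuous (inf :: 'a::complete_lattice \<Rightarrow> 'a \<Rightarrow> 'a)"
  by (simp add: right_continuous_def INF_inf_const1)

theorem theorem5p1:
  assumes "rectangular TYPE('a::{finite, complete_lattice})"
    and "modular TYPE('a)"
  shows "(one_distributive TYPE('a) \<longleftrightarrow> distributive TYPE('a)) \<and>
    (distributive TYPE('a) \<longleftrightarrow>
      (\<exists>T :: 'a \<Rightarrow> 'a \<Rightarrow> 'a. t_norm T \<and> left_continuous T \<and> right_continuous T)) \<and>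
    ((\<exists>T :: 'a \<Rightarrow> 'a \<Rightarrow> 'a. t_norm T \<and> left_continuous T \<and> right_continuous T) \<longleftrightarrow>
      (\<exists>T :: 'a \<Rightarrow> 'a \<Rightarrow> 'a. t_norm T \<and> left_continuous T)) \<and>
    ((\<exists>T :: 'a \<Rightarrow> 'a \<Rightarrow> 'a. t_norm T \<and> left_continuous T) \<longleftrightarrow>
      (\<exists>T :: 'a \<Rightarrow> 'a \<Rightarrow> 'a. pseudo_t_norm T \<and> left_continuous T))"
proof -
  let ?i = "one_distributive TYPE('a)"
  let ?ii = "distributive TYPE('a)"
  let ?iii = "\<exists>T :: 'a \<Rightarrow> 'a \<Rightarrow> 'a. t_norm T \<and> left_continuous T \<and> right_continuous T"
  let ?iv = "\<exists>T :: 'a \<Rightarrow> 'a \<Rightarrow> 'a. t_norm T \<and> left_continuous T"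
  let ?v = "\<exists>T :: 'a \<Rightarrow> 'a \<Rightarrow> 'a. pseudo_t_norm T \<and> left_continuous T"
  have "?i \<Longrightarrow> ?ii"
    using distributive_if_one_distributive[OF assms] .
  moreover have "?ii \<Longrightarrow> ?iii"
    using t_norm_inf left_continuous_inf right_continuous_inf by blast
  moreover have "?iii \<Longrightarrow> ?iv"
    by blast
  moreover have "?iv \<Longrightarrow> ?v"
    using pseudo_t_norm_if_t_norm by blast
  moreover have "?v \<Longrightarrow> ?i"
    using one_distributive_if_left_continuous by blast
  ultimately show ?thesis
    by argo
qed

end
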